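(* Let $f:\mathbb{R}^d\to\mathbb{R}$ be such that $\hat f\in L^1(\mathbb{R}^d)$ and $\hat f$ is not almost everywhere zero. The probability density $$p_*(\omega)=\frac{|\hat f(\omega)|}{\int_{\mathbb{R}^d}|\hat f(\omega')|\,d\omega'}$$ is the solution of the minimization problem $$\min_{p,\ \int_{\mathbb{R}^d}p(\omega)\,d\omega=1}\left\{\frac{1}{(2\pi)^d}\int_{\mathbb{R}^d}\frac{|\hat f(\omega)|^2}{p(\omega)}\,d\omega\right\},$$ where the minimum is over probability densities $p:\mathbb{R}^d\to[0,\infty)$.
   Context: The Fourier transform of an integrable function $f$ is $\hat f(\omega)=(2\pi)^{-d/2}\int_{\mathbb{R}^d}f(x)e^{-\mathrm{i}\omega\cdot x}\,dx$; $f\in L^1(\mathbb{R}^d)$ is assumed. In the integrand $|\hat f(\omega)|^2/p(\omega)$, at points where $p(\omega)=0$ the value is taken to be $0$ if $\hat f(\omega)=0$ and $+\infty$ otherwise; the integral may take the value $+\infty$. *)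

theory Defs
  imports "HOL-Analysis.Analysis"
begin

definition fourier :: "('a::euclidean_space \<Rightarrow> real) \<Rightarrow> 'a \<Rightarrow> complex" where
  "fourier f \<omega> = complex_of_real ((2 * pi) powr (- real DIM('a) / 2)) *
     (LINT x|lebesgue. complex_of_real (f x) * exp (- \<i> * complex_of_real (\<omega> \<bullet> x)))"

definition prob_density :: "('a::euclidean_space \<Rightarrow> real) \<Rightarrow> bool" where
  "prob_density p \<longleftrightarrow> p \<in> borel_measurable lebesgue \<and> (\<forall>\<omega>. 0 \<le> p \<omega>) \<and>
     (\<integral>\<^sup>+\<omega>. ennreal (p \<omega>) \<partial>lebesgue) = 1"

text \<open>
  The quotient is taken in \<^typ>\<open>ennreal\<close>, where \<open>0 / 0 = 0\<close> and \<open>a / 0 = \<infinity>\<close> for \<open>a \<noteq> 0\<close>. This is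
  the convention wanted at points where \<open>p\<close> vanishes; elsewhere it is the real quotient.
\<close>
definition sampling_cost :: "('a::euclidean_space \<Rightarrow> real) \<Rightarrow> ('a \<Rightarrow> real) \<Rightarrow> ennreal" where
  "sampling_cost f p = ennreal (1 / (2 * pi) ^ DIM('a)) *
     (\<integral>\<^sup>+\<omega>. ennreal ((cmod (fourier f \<omega>))\<^sup>2) / ennreal (p \<omega>) \<partial>lebesgue)"

definition p_star :: "('a::euclidean_space \<Rightarrow> real) \<Rightarrow> 'a \<Rightarrow> real" where
  "p_star f \<omega> = cmod (fourier f \<omega>) / (LINT \<omega>'|lebesgue. cmod (fourier f \<omega>'))"

end

theory Submission
  imports Defs
begin

text \<open>
  Write \<open>g\<close> for the modulus of the Fourier transform of \<open>f\<close> and \<open>I\<close> for its integral, which is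
  finite and positive. Completing the square in the numerator gives, for every \<open>p \<ge> 0\<close>,
  \<open>g\<^sup>2 / p + I\<^sup>2 p = 2 I g + (g - I p)\<^sup>2 / p\<close>.
  This is an identity in \<^typ>\<open>ennreal\<close> even where \<open>p\<close> vanishes, because both quotients are then
  \<open>0\<close> or both are \<open>\<infinity>\<close>, according to whether \<open>g\<close> vanishes. Integrating
  it with \<open>\<integral> p = 1\<close> and cancelling the finite term \<open>I\<^sup>2\<close> yields
  \<open>\<integral> g\<^sup>2 / p = I\<^sup>2 + \<integral> (g - I p)\<^sup>2 / p\<close>.
  The excess term is nonnegative, and it is zero exactly when \<open>g = I p\<close> almost everywhere. Hence
  \<open>g / I\<close> is a minimizer and, up to null sets, the only one. For positive \<open>p\<close>, the
  last formula is the Cauchy--Schwarz inequality \<open>I\<^sup>2 = (\<integral> (g / \<surd>p) \<surd>p)\<^sup>2 \<le> \<integral> g\<^sup>2 / p\<close> with its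
  defect made explicit.
\<close>

text \<open>
  For \<open>q > 0\<close> this is the expansion of the square. The terms are arranged so that no subtraction
  of possibly infinite quantities occurs and the case \<open>q = 0\<close> is covered.
\<close>

lemma ennreal_complete_square_divide:
  fixes a q c :: real
  assumes "0 \<le> a" "0 \<le> q" "0 \<le> c"
  shows "ennreal (a\<^sup>2) / ennreal q + ennreal (c\<^sup>2) * ennreal q =
    ennreal (2 * c) * ennreal a + ennreal ((a - c * q)\<^sup>2) / ennreal q"
proof (cases "q = 0")
  case True
  show ?thesis
  proof (cases "a = 0")
    case True
    with \<open>q = 0\<close> show ?thesis by simp
  next
    case False
    then have "ennreal (a\<^sup>2) / ennreal q = \<infinity>"
      using \<open>q = 0\<close> by (simp add: ennreal_divide_eq_top_iff)
    then show ?thesis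
      using \<open>q = 0\<close> by simp
  qed
next
  case False
  with assms have q: "0 < q" by simp
  have "a\<^sup>2 / q + c\<^sup>2 * q = 2 * c * a + (a - c * q)\<^sup>2 / q"
    using q by (simp add: field_simps power2_eq_square)
  then show ?thesis
    using assms q by (simp add: divide_ennreal flip: ennreal_mult ennreal_plus)
qed

lemma nn_integral_square_divide_density:
  fixes g p :: "'a \<Rightarrow> real"
  assumes g: "integrable M g" "\<And>x. 0 \<le> g x"
    and p: "p \<in> borel_measurable M" "\<And>x. 0 \<le> p x" "(\<integral>\<^sup>+x. ennreal (p x) \<partial>M) = 1"
  defines "I \<equiv> LINT x|M. g x"
  shows "(\<integral>\<^sup>+x. ennreal ((g x)\<^sup>2) / ennreal (p x) \<partial>M) =
    ennreal (I\<^sup>2) + (\<integral>\<^sup>+x. ennreal ((g x - I * p x)\<^sup>2) / ennreal (p x) \<partial>M)"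
    (is "?J = _ + ?D")
proof -
  have [measurable]: "g \<in> borel_measurable M" "p \<in> borel_measurable M"
    using g p by auto
  have I: "0 \<le> I"
    unfolding I_def using g by (simp add: integral_nonneg_AE)
  have int_g: "(\<integral>\<^sup>+x. ennreal (g x) \<partial>M) = ennreal I"
    unfolding I_def using g by (intro nn_integral_eq_integral) auto
  have "?J + ennreal (I\<^sup>2) =
      (\<integral>\<^sup>+x. ennreal ((g x)\<^sup>2) / ennreal (p x) + ennreal (I\<^sup>2) * ennreal (p x) \<partial>M)"
    by (simp add: nn_integral_add nn_integral_cmult p(3))
  also have "\<dots> =
      (\<integral>\<^sup>+x. ennreal (2 * I) * ennreal (g x) + ennreal ((g x - I * p x)\<^sup>2) / ennreal (p x) \<partial>M)"
    using g(2) p(2) I by (simp add: ennreal_complete_square_divide)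
  also have "\<dots> = ennreal (2 * I) * ennreal I + ?D"
    by (simp add: nn_integral_add nn_integral_cmult int_g)
  also have "ennreal (2 * I) * ennreal I = ennreal (I\<^sup>2) + ennreal (I\<^sup>2)"
    using I by (simp add: power2_eq_square flip: ennreal_mult ennreal_plus)
  finally have "ennreal (I\<^sup>2) + ?J = ennreal (I\<^sup>2) + (ennreal (I\<^sup>2) + ?D)"
    by (simp add: ac_simps)
  then show ?thesis
    by (simp add: ennreal_add_left_cancel)
qed

text \<open>
  A nonnegative integrand with integral zero vanishes almost everywhere. At points where \<open>p \<le> 0\<close>
  this still gives \<open>g = c p\<close>, since a positive numerator would make the quotient infinite.
\<close>

lemma nn_integral_defect_eq_0_iff:
  fixes g p :: "'a \<Rightarrow> real"
  assumes [measurable]: "g \<in> borel_measurable M" "p \<in> borel_measurable M"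
  shows "(\<integral>\<^sup>+x. ennreal ((g x - c * p x)\<^sup>2) / ennreal (p x) \<partial>M) = 0 \<longleftrightarrow>
    (AE x in M. g x = c * p x)"
proof -
  have "ennreal ((g x - c * p x)\<^sup>2) / ennreal (p x) = 0 \<longleftrightarrow> g x = c * p x" for x
    by (auto simp: ennreal_divide_eq_0_iff)
  then show ?thesis
    by (simp add: nn_integral_0_iff_AE)
qed

theorem theorem2p2:
  fixes f :: "'a::euclidean_space \<Rightarrow> real"
  assumes "integrable lebesgue f"
    and "integrable lebesgue (fourier f)"
    and "\<not> (AE \<omega> in lebesgue. fourier f \<omega> = 0)"
  shows "is_arg_min (sampling_cost f) prob_density (p_star f) \<and>
    (\<forall>p. is_arg_min (sampling_cost f) prob_density p \<longrightarrow> (AE \<omega> in lebesgue. p \<omega> = p_star f \<omega>))"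
proof -
  define g where "g = (\<lambda>\<omega>. cmod (fourier f \<omega>))"
  define I where "I = (LINT \<omega>|lebesgue. g \<omega>)"
  define D where "D p = (\<integral>\<^sup>+\<omega>. ennreal ((g \<omega> - I * p \<omega>)\<^sup>2) / ennreal (p \<omega>) \<partial>lebesgue)" for p
  define C where "C = ennreal (1 / (2 * pi) ^ DIM('a))"
  have g: "integrable lebesgue g" "\<And>\<omega>. 0 \<le> g \<omega>"
    unfolding g_def using assms(2) by auto
  then have [measurable]: "g \<in> borel_measurable lebesgue" by auto
  have "I \<noteq> 0"
    using assms(3) integral_nonneg_eq_0_iff_AE[of lebesgue g] g by (simp add: I_def g_def)
  moreover have "0 \<le> I"
    unfolding I_def using g by (simp add: integral_nonneg_AE)
  ultimately have I: "0 < I" by simp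
  have p_star: "p_star f = (\<lambda>\<omega>. g \<omega> / I)"
    by (simp add: p_star_def g_def I_def fun_eq_iff)
  have "(\<integral>\<^sup>+\<omega>. ennreal (g \<omega> / I) \<partial>lebesgue) = ennreal (LINT \<omega>|lebesgue. g \<omega> / I)"
    using g I by (intro nn_integral_eq_integral) auto
  also have "\<dots> = 1"
    using I by (simp flip: I_def)
  finally have density: "prob_density (p_star f)"
    using g(2) I by (simp add: prob_density_def p_star)
  have cost: "sampling_cost f p = C * (ennreal (I\<^sup>2) + D p)" if "prob_density p" for p
    using nn_integral_square_divide_density[OF g, of p] that
    by (simp add: sampling_cost_def prob_density_def C_def D_def I_def g_def)
  have D_eq_0: "D p = 0 \<longleftrightarrow> (AE \<omega> in lebesgue. p \<omega> = p_star f \<omega>)" if "prob_density p" for p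
  proof -
    have "D p = 0 \<longleftrightarrow> (AE \<omega> in lebesgue. g \<omega> = I * p \<omega>)"
      using that unfolding D_def prob_density_def
      by (intro nn_integral_defect_eq_0_iff) auto
    also have "\<dots> \<longleftrightarrow> (AE \<omega> in lebesgue. p \<omega> = p_star f \<omega>)"
      using I by (intro AE_cong) (auto simp: p_star field_simps)
    finally show ?thesis .
  qed
  have cost_star: "sampling_cost f (p_star f) = C * ennreal (I\<^sup>2)"
    using cost[OF density] D_eq_0[OF density] by simp
  have C: "C \<noteq> 0" "C \<noteq> \<infinity>"
    by (simp_all add: C_def)
  have "is_arg_min (sampling_cost f) prob_density (p_star f)"
    unfolding is_arg_min_def using density
    by (auto simp: cost cost_star not_less intro!: mult_left_mono)
  moreover have "AE \<omega> in lebesgue. p \<omega> = p_star f \<omega>"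
    if "is_arg_min (sampling_cost f) prob_density p" for p
  proof -
    have p: "prob_density p" and "sampling_cost f p \<le> sampling_cost f (p_star f)"
      using that density by (auto simp: is_arg_min_def not_less)
    then have "C * (ennreal (I\<^sup>2) + D p) \<le> C * ennreal (I\<^sup>2)"
      by (simp add: cost cost_star)
    then have "ennreal (I\<^sup>2) + D p \<le> ennreal (I\<^sup>2) + 0"
      using C by (simp add: ennreal_mult_le_mult_iff)
    then have "D p = 0"
      by (simp only: ennreal_add_left_cancel_le) auto
    with D_eq_0[OF p] show ?thesis by simp
  qed
  ultimately show ?thesis by blast
qed

end
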